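(* Let $\mathcal V$ be a finite nonempty set, let $\tilde\pi$ and $\pi_{\mathrm{old}}$ be probability distributions on $\mathcal V$ with $\tilde\pi(o)>0$ and $\pi_{\mathrm{old}}(o)>0$ for all $o\in\mathcal V$, and let $\epsilon>0$. Consider the optimization problem $$\min_{\hat\pi}\ \mathrm{KL}(\hat\pi\,\|\,\tilde\pi)\quad\text{subject to}\quad \mathrm{KL}(\hat\pi\,\|\,\pi_{\mathrm{old}})\le\epsilon,$$ where $\hat\pi$ ranges over all probability distributions on $\mathcal V$. Then the solution $\pi$ of this problem is given by $$\pi(o)\ \propto\ \exp\left(\frac{\eta^*\log\pi_{\mathrm{old}}(o)+\log\tilde\pi(o)}{\eta^*+1}\right),\qquad o\in\mathcal V,$$ (normalized so that $\sum_{o\in\mathcal V}\pi(o)=1$), where $$\eta^*=\arg\max_{\eta\ge 0}D(\eta),\qquad D(\eta)=-\eta\,\epsilon-(\eta+1)\log\sum_{o\in\mathcal V}\exp\left(\frac{\log\tilde\pi(o)+\eta\log\pi_{\mathrm{old}}(o)}{\eta+1}\right).$$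
   Context: For probability distributions $p,q$ on a finite set $\mathcal V$ with $q>0$ everywhere, $\mathrm{KL}(p\,\|\,q)=\sum_{o\in\mathcal V}p(o)\log\frac{p(o)}{q(o)}$, with $0\log 0=0$. *)

theory Defs
  imports "HOL-Probability.Probability_Mass_Function"
begin

definition distributions_on :: "'a set \<Rightarrow> 'a pmf set" where
  "distributions_on V = {p. set_pmf p \<subseteq> V}"

text \<open>
  The first factor makes every term with \<open>pmf p x = 0\<close> vanish, which is the convention
  \<open>0 log 0 = 0\<close>. The definition is meant for finite \<open>V\<close> and for \<open>q\<close> positive on \<open>V\<close>.
\<close>
definition KL :: "'a set \<Rightarrow> 'a pmf \<Rightarrow> 'a pmf \<Rightarrow> real" where
  "KL V p q = (\<Sum>x\<in>V. pmf p x * ln (pmf p x / pmf q x))"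

definition dual_objective ::
  "'a set \<Rightarrow> 'a pmf \<Rightarrow> 'a pmf \<Rightarrow> real \<Rightarrow> real \<Rightarrow> real" where
  "dual_objective V pi_tilde pi_old \<epsilon> \<eta> =
     - \<eta> * \<epsilon> - (\<eta> + 1) *
       ln (\<Sum>x\<in>V. exp ((ln (pmf pi_tilde x) + \<eta> * ln (pmf pi_old x)) / (\<eta> + 1)))"

definition KL_feasible :: "'a set \<Rightarrow> 'a pmf \<Rightarrow> real \<Rightarrow> 'a pmf \<Rightarrow> bool" where
  "KL_feasible V pi_old \<epsilon> p \<longleftrightarrow> p \<in> distributions_on V \<and> KL V p pi_old \<le> \<epsilon>"

end

theory Submission imports Defs begin

text \<open>
  Up to a normalising constant, the Lagrangian
  \<open>KL(p, pi_tilde) + \<eta> KL(p, pi_old)\<close> is \<open>\<eta> + 1\<close> times the divergence of \<open>p\<close> from the tilted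
  distribution \<open>p\<^sub>\<eta>\<close> of the theorem. By Gibbs' inequality \<open>p\<^sub>\<eta>\<close> is its unique minimiser, and
  \<open>D(\<eta>)\<close> is the minimum less \<open>\<eta> \<epsilon>\<close>. Hence \<open>D(\<eta>') \<le> D(\<eta>) + (\<eta>' - \<eta>) (K(\<eta>) - \<epsilon>)\<close> with
  \<open>K(\<eta>) = KL(p\<^sub>\<eta>, pi_old)\<close>, and continuity of \<open>K\<close> turns these inequalities into the
  Karush-Kuhn-Tucker conditions at a maximiser of \<open>D\<close>, without differentiation. A maximiser
  exists because \<open>D(\<eta>) \<le> KL(pi_old, pi_tilde) - \<eta> \<epsilon>\<close>. If there were two, the tilted
  distributions would coincide, which forces \<open>pi_tilde = pi_old\<close> and so \<open>D(\<eta>) = - \<eta> \<epsilon>\<close>.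
\<close>

section \<open>Gibbs' inequality and its equality case\<close>

text \<open>This is \<open>ln u \<le> u - 1\<close> at \<open>u = t / s\<close>, multiplied by
  \<open>s\<close>.\<close>

lemma mult_ln_divide_ge_diff:
  fixes s t :: real
  assumes "0 \<le> s" "0 < t"
  shows "s - t \<le> s * ln (s / t)"
proof (cases "s = 0")
  case False
  with assms have "s > 0" by simp
  have "ln (t / s) \<le> t / s - 1"
    using \<open>s > 0\<close> assms by (intro ln_le_minus_one) simp
  then have "s * ln (t / s) \<le> s * (t / s - 1)"
    using \<open>s > 0\<close> by (intro mult_left_mono) auto
  with \<open>s > 0\<close> assms show ?thesis by (simp add: ln_div algebra_simps)
qed (use assms in simp)

text \<open>Equality in \<open>ln u \<le> u - 1\<close> forces \<open>u = 1\<close>. For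
  \<open>s = 0\<close> the assumed equation would give \<open>t = 0\<close>.\<close>

lemma mult_ln_divide_eq_diff_imp_eq:
  fixes s t :: real
  assumes "0 \<le> s" "0 < t" "s * ln (s / t) = s - t"
  shows "s = t"
proof (cases "s = 0")
  case False
  with assms have "s > 0" by simp
  have "s * ln (t / s) = s * (t / s - 1)"
    using \<open>s > 0\<close> assms by (simp add: ln_div algebra_simps)
  then have "ln (t / s) = t / s - 1" using \<open>s > 0\<close> by simp
  then have "t / s = 1" using \<open>s > 0\<close> assms by (intro ln_eq_minus_one) auto
  with \<open>s > 0\<close> show ?thesis by simp
qed (use assms in simp)

lemma pmf_outside: "p \<in> distributions_on V \<Longrightarrow> x \<notin> V \<Longrightarrow> pmf p x = 0"
  by (auto simp: distributions_on_def set_pmf_iff)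

text \<open>The correction sums to 0 because both masses are 1. It makes each summand nonnegative
  when \<open>q\<close> is positive on \<open>V\<close>, so divergences can be compared with 0 term
  by term.\<close>

lemma KL_eq_sum_diff:
  assumes "finite V" "p \<in> distributions_on V" "q \<in> distributions_on V"
  shows "KL V p q = (\<Sum>x\<in>V. pmf p x * ln (pmf p x / pmf q x) - (pmf p x - pmf q x))"
  using assms by (simp add: KL_def sum_subtractf distributions_on_def sum_pmf_eq_1)

lemma KL_nonneg:
  assumes "finite V" "p \<in> distributions_on V" "q \<in> distributions_on V" "\<forall>x\<in>V. pmf q x > 0"
  shows "KL V p q \<ge> 0"
  unfolding KL_eq_sum_diff[OF assms(1-3)]
  using assms(4) by (intro sum_nonneg) (simp add: mult_ln_divide_ge_diff)

lemma KL_eq_0_imp_eq: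
  assumes "finite V" "p \<in> distributions_on V" "q \<in> distributions_on V" "\<forall>x\<in>V. pmf q x > 0"
    and "KL V p q = 0"
  shows "p = q"
proof (rule pmf_eqI)
  fix x
  have "\<forall>x\<in>V. pmf p x * ln (pmf p x / pmf q x) - (pmf p x - pmf q x) = 0"
    using assms(5) unfolding KL_eq_sum_diff[OF assms(1-3)]
    by (subst (asm) sum_nonneg_eq_0_iff) (use assms(1,4) in \<open>auto simp: mult_ln_divide_ge_diff\<close>)
  then have "x \<in> V \<Longrightarrow> pmf p x = pmf q x"
    using assms(4) mult_ln_divide_eq_diff_imp_eq[of "pmf p x" "pmf q x"] by auto
  moreover have "x \<notin> V \<Longrightarrow> pmf p x = pmf q x"
    using assms(2,3) by (simp add: pmf_outside)
  ultimately show "pmf p x = pmf q x" by blast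
qed

lemma KL_self:
  "KL V p p = 0"
  unfolding KL_def
proof (intro sum.neutral ballI)
  fix x
  show "pmf p x * ln (pmf p x / pmf p x) = 0" by (cases "pmf p x = 0") auto
qed

section \<open>The tilted distributions\<close>

locale KL_projection =
  fixes V :: "'a set" and pi_tilde pi_old :: "'a pmf" and \<epsilon> :: real
  assumes fin: "finite V" and nonempty: "V \<noteq> {}"
    and tilde_on: "pi_tilde \<in> distributions_on V" and old_on: "pi_old \<in> distributions_on V"
    and tilde_pos: "\<And>x. x \<in> V \<Longrightarrow> pmf pi_tilde x > 0"
    and old_pos: "\<And>x. x \<in> V \<Longrightarrow> pmf pi_old x > 0"
    and eps_pos: "\<epsilon> > 0"
begin

text \<open>For \<open>\<eta> \<ge> 0\<close>, on \<open>V\<close>, this is the geometric mean of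
  \<open>pi_tilde\<close> and \<open>pi_old\<close> with exponents \<open>1 / (\<eta> + 1)\<close>
  and \<open>\<eta> / (\<eta> + 1)\<close>.\<close>

definition weight :: "real \<Rightarrow> 'a \<Rightarrow> real" where
  "weight \<eta> x = exp ((ln (pmf pi_tilde x) + \<eta> * ln (pmf pi_old x)) / (\<eta> + 1))"

definition partition_fun :: "real \<Rightarrow> real" where
  "partition_fun \<eta> = (\<Sum>x\<in>V. weight \<eta> x)"

definition tilted :: "real \<Rightarrow> 'a pmf" where
  "tilted \<eta> = embed_pmf (\<lambda>x. if x \<in> V then weight \<eta> x / partition_fun \<eta> else 0)"

definition D :: "real \<Rightarrow> real" where
  "D = dual_objective V pi_tilde pi_old \<epsilon>"

lemma D_eq: "D \<eta> = - \<eta> * \<epsilon> - (\<eta> + 1) * ln (partition_fun \<eta>)"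
  by (simp add: D_def dual_objective_def partition_fun_def weight_def)

lemma partition_fun_pos: "partition_fun \<eta> > 0"
  unfolding partition_fun_def weight_def using fin nonempty by (intro sum_pos) auto

lemma pmf_tilted: "pmf (tilted \<eta>) x = (if x \<in> V then weight \<eta> x / partition_fun \<eta> else 0)"
  unfolding tilted_def
proof (rule pmf_embed_pmf)
  show nonneg: "0 \<le> (if x \<in> V then weight \<eta> x / partition_fun \<eta> else 0)" for x
    using partition_fun_pos[of \<eta>] by (simp add: weight_def)
  have "(\<integral>\<^sup>+x. ennreal (if x \<in> V then weight \<eta> x / partition_fun \<eta> else 0) \<partial>count_space UNIV)
      = (\<Sum>x\<in>V. ennreal (if x \<in> V then weight \<eta> x / partition_fun \<eta> else 0))"
    using fin by (intro nn_integral_count_space') auto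
  also have "\<dots> = ennreal (\<Sum>x\<in>V. if x \<in> V then weight \<eta> x / partition_fun \<eta> else 0)"
    using nonneg by (intro sum_ennreal)
  also have "(\<Sum>x\<in>V. if x \<in> V then weight \<eta> x / partition_fun \<eta> else 0) = 1"
    using partition_fun_pos[of \<eta>] by (simp flip: sum_divide_distrib partition_fun_def)
  finally show "(\<integral>\<^sup>+x. ennreal (if x \<in> V then weight \<eta> x / partition_fun \<eta> else 0)
      \<partial>count_space UNIV) = 1" by simp
qed

lemma tilted_pos: "x \<in> V \<Longrightarrow> pmf (tilted \<eta>) x > 0"
  using partition_fun_pos[of \<eta>] by (simp add: pmf_tilted weight_def)

lemma tilted_on: "tilted \<eta> \<in> distributions_on V"
  by (auto simp: distributions_on_def set_pmf_eq pmf_tilted split: if_splits)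

section \<open>The Lagrangian and weak duality\<close>

text \<open>By construction \<open>(\<eta> + 1) * ln (pmf (tilted \<eta>) x)\<close> is
  \<open>ln (pmf pi_tilde x) + \<eta> * ln (pmf pi_old x)\<close> minus a constant. The two
  divergences thus merge into one, and the constant passes through the sum since \<open>p\<close>
  has mass 1.\<close>

lemma lagrangian_eq:
  assumes p: "p \<in> distributions_on V" and "\<eta> \<ge> 0"
  shows "KL V p pi_tilde + \<eta> * (KL V p pi_old - \<epsilon>) = D \<eta> + (\<eta> + 1) * KL V p (tilted \<eta>)"
proof -
  define c where "c = (\<eta> + 1) * ln (partition_fun \<eta>)"
  have "pmf p x * ln (pmf p x / pmf pi_tilde x) + \<eta> * (pmf p x * ln (pmf p x / pmf pi_old x))
      = (\<eta> + 1) * (pmf p x * ln (pmf p x / pmf (tilted \<eta>) x)) - pmf p x * c"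
    if x: "x \<in> V" for x
  proof (cases "pmf p x = 0")
    case False
    then have pos: "pmf p x > 0" by (simp add: pmf_pos)
    have "ln (pmf (tilted \<eta>) x)
        = (ln (pmf pi_tilde x) + \<eta> * ln (pmf pi_old x)) / (\<eta> + 1) - ln (partition_fun \<eta>)"
      using x partition_fun_pos[of \<eta>] by (simp add: pmf_tilted ln_div weight_def)
    then have "(\<eta> + 1) * ln (pmf (tilted \<eta>) x)
        = ln (pmf pi_tilde x) + \<eta> * ln (pmf pi_old x) - c"
      using \<open>\<eta> \<ge> 0\<close> by (simp add: right_diff_distrib c_def)
    then have "ln (pmf p x / pmf pi_tilde x) + \<eta> * ln (pmf p x / pmf pi_old x)
        = (\<eta> + 1) * ln (pmf p x / pmf (tilted \<eta>) x) - c"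
      using x pos tilde_pos[OF x] old_pos[OF x] tilted_pos[OF x, of \<eta>]
      by (simp add: ln_div algebra_simps)
    then have "pmf p x * (ln (pmf p x / pmf pi_tilde x) + \<eta> * ln (pmf p x / pmf pi_old x))
        = pmf p x * ((\<eta> + 1) * ln (pmf p x / pmf (tilted \<eta>) x) - c)" by simp
    then show ?thesis by (simp add: algebra_simps)
  qed simp
  then have "KL V p pi_tilde + \<eta> * KL V p pi_old
      = (\<eta> + 1) * KL V p (tilted \<eta>) - (\<Sum>x\<in>V. pmf p x) * c"
    unfolding KL_def
    by (simp add: sum_distrib_left sum_distrib_right flip: sum.distrib sum_subtractf)
  moreover have "(\<Sum>x\<in>V. pmf p x) = 1"
    using p fin by (simp add: distributions_on_def sum_pmf_eq_1)
  ultimately show ?thesis by (simp add: D_eq c_def algebra_simps)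
qed

lemma D_le_lagrangian:
  assumes "p \<in> distributions_on V" "\<eta> \<ge> 0"
  shows "D \<eta> \<le> KL V p pi_tilde + \<eta> * (KL V p pi_old - \<epsilon>)"
  unfolding lagrangian_eq[OF assms]
  using KL_nonneg[OF fin assms(1) tilted_on, of \<eta>] tilted_pos assms(2) by simp

lemma D_eq_lagrangian_imp_eq_tilted:
  assumes "p \<in> distributions_on V" "\<eta> \<ge> 0"
    and "KL V p pi_tilde + \<eta> * (KL V p pi_old - \<epsilon>) \<le> D \<eta>"
  shows "p = tilted \<eta>"
proof -
  have "KL V p (tilted \<eta>) \<le> 0"
    using assms(2,3) unfolding lagrangian_eq[OF assms(1,2)] by (simp add: mult_le_0_iff)
  then show ?thesis
    using KL_nonneg[OF fin assms(1) tilted_on, of \<eta>] tilted_pos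
    by (intro KL_eq_0_imp_eq[OF fin assms(1) tilted_on]) auto
qed

lemma D_eq_lagrangian_tilted:
  assumes "\<eta> \<ge> 0"
  shows "D \<eta> = KL V (tilted \<eta>) pi_tilde + \<eta> * (KL V (tilted \<eta>) pi_old - \<epsilon>)"
  using lagrangian_eq[OF tilted_on assms] by (simp add: KL_self)

text \<open>For fixed \<open>p\<close> the Lagrangian is affine in the multiplier and bounds
  \<open>D\<close> from above. The choice \<open>p = tilted \<eta>\<close> makes this line touch
  \<open>D\<close> at \<open>\<eta>\<close>, so its slope is a supergradient.\<close>

lemma D_le_tangent:
  assumes "\<eta> \<ge> 0" "\<eta>' \<ge> 0"
  shows "D \<eta>' \<le> D \<eta> + (\<eta>' - \<eta>) * (KL V (tilted \<eta>) pi_old - \<epsilon>)"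
  using D_le_lagrangian[OF tilted_on assms(2), of \<eta>] D_eq_lagrangian_tilted[OF assms(1)]
  by (simp add: algebra_simps)

section \<open>Continuity and existence of a dual maximiser\<close>

lemma continuous_on_weight: "continuous_on {0..} (\<lambda>\<eta>. weight \<eta> x)"
  unfolding weight_def by (intro continuous_intros) auto

lemma continuous_on_partition_fun: "continuous_on {0..} partition_fun"
  unfolding partition_fun_def by (intro continuous_intros continuous_on_weight)

lemma continuous_on_D: "continuous_on {0..} D"
  unfolding D_eq using partition_fun_pos
  by (intro continuous_intros continuous_on_partition_fun) (auto simp: less_imp_neq[symmetric])

lemma continuous_on_KL_tilted: "continuous_on {0..} (\<lambda>\<eta>. KL V (tilted \<eta>) pi_old)"
proof -
  have "continuous_on {0..} (\<lambda>\<eta>. \<Sum>x\<in>V. (weight \<eta> x / partition_fun \<eta>) *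
      ln (weight \<eta> x / partition_fun \<eta> / pmf pi_old x))"
    using partition_fun_pos old_pos
    by (intro continuous_intros continuous_on_weight continuous_on_partition_fun)
      (auto simp: less_imp_neq[symmetric] weight_def)
  then show ?thesis by (simp add: KL_def pmf_tilted)
qed

lemma maximizer_exists: "\<exists>\<eta>\<ge>0. \<forall>\<eta>'\<ge>0. D \<eta>' \<le> D \<eta>"
proof -
  \<comment> \<open>Weak duality at \<open>p = pi_old\<close> gives
    \<open>D \<eta>' \<le> 0 = D 0\<close> beyond \<open>b\<close>, so a maximiser on the compact
    interval \<open>{0..b}\<close> is global.\<close>
  define b where "b = KL V pi_old pi_tilde / \<epsilon>"
  have b: "b \<ge> 0"
    using KL_nonneg[OF fin old_on tilde_on] tilde_pos eps_pos by (simp add: b_def)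
  obtain \<eta> where \<eta>: "\<eta> \<in> {0..b}" "\<And>\<eta>'. \<eta>' \<in> {0..b} \<Longrightarrow> D \<eta>' \<le> D \<eta>"
    using continuous_attains_sup[of "{0..b}" D] b continuous_on_subset[OF continuous_on_D]
    by (metis Icc_subset_Ici_iff atLeastatMost_empty_iff compact_Icc order_refl linorder_not_less)
  have "(\<Sum>x\<in>V. pmf pi_tilde x) = 1"
    using tilde_on fin by (simp add: distributions_on_def sum_pmf_eq_1)
  then have D0: "D 0 = 0"
    using tilde_pos by (simp add: D_eq partition_fun_def weight_def)
  have "D \<eta>' \<le> D \<eta>" if "\<eta>' \<ge> 0" for \<eta>'
  proof (cases "\<eta>' \<le> b")
    case False
    then have "KL V pi_old pi_tilde \<le> \<eta>' * \<epsilon>"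
      using eps_pos by (simp add: b_def field_simps)
    then have "D \<eta>' \<le> 0"
      using D_le_lagrangian[OF old_on that] by (simp add: KL_self)
    also have "\<dots> \<le> D \<eta>" using \<eta>(2)[of 0] b D0 by simp
    finally show ?thesis .
  qed (use \<eta>(2) that in auto)
  with \<eta>(1) show ?thesis by auto
qed

section \<open>Karush-Kuhn-Tucker conditions and primal optimality\<close>

lemma
  assumes "\<eta> \<ge> 0" and max: "\<And>\<eta>'. \<eta>' \<ge> 0 \<Longrightarrow> D \<eta>' \<le> D \<eta>"
  shows KL_tilted_maximizer_le: "KL V (tilted \<eta>) pi_old \<le> \<epsilon>"
    and complementary_slackness: "\<eta> * (KL V (tilted \<eta>) pi_old - \<epsilon>) = 0"
proof -
  let ?K = "\<lambda>\<eta>. KL V (tilted \<eta>) pi_old"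
  \<comment> \<open>The supporting line is taken at \<open>\<eta>'\<close> and evaluated at the
    maximiser \<open>\<eta>\<close>. It bounds \<open>?K\<close> by \<open>\<epsilon>\<close> from
    above to the right of \<open>\<eta>\<close> and from below to the left; one-sided limits carry
    both bounds to \<open>\<eta>\<close>.\<close>
  have sign: "0 \<le> (\<eta> - \<eta>') * (?K \<eta>' - \<epsilon>)" if "\<eta>' \<ge> 0" for \<eta>'
    using D_le_tangent[OF that \<open>\<eta> \<ge> 0\<close>] max[OF that] by simp
  have right: "?K \<eta>' \<le> \<epsilon>" if "\<eta>' > \<eta>" for \<eta>'
    using sign[of \<eta>'] that \<open>\<eta> \<ge> 0\<close> by (simp add: zero_le_mult_iff)
  have left: "\<epsilon> \<le> ?K \<eta>'" if "\<eta>' \<ge> 0" "\<eta>' < \<eta>" for \<eta>'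
    using sign[of \<eta>'] that by (simp add: zero_le_mult_iff)
  have lim: "(?K \<longlongrightarrow> ?K \<eta>) (at \<eta> within {0..})"
    using continuous_on_KL_tilted \<open>\<eta> \<ge> 0\<close> by (simp add: continuous_on_def)
  have "(?K \<longlongrightarrow> ?K \<eta>) (at_right \<eta>)"
    using \<open>\<eta> \<ge> 0\<close> by (intro tendsto_within_subset[OF lim]) auto
  then show le: "?K \<eta> \<le> \<epsilon>"
    by (rule tendsto_upperbound) (auto intro!: always_eventually right simp: eventually_at_filter)
  show "\<eta> * (?K \<eta> - \<epsilon>) = 0"
  \<comment> \<open>A limit from the left within \<open>{0..}\<close> is available only for
    \<open>\<eta> > 0\<close>; at 0 the product vanishes anyway.\<close>
  proof (cases "\<eta> = 0")
    case False
    with \<open>\<eta> \<ge> 0\<close> have "\<eta> > 0" by simp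
    have "(?K \<longlongrightarrow> ?K \<eta>) (at \<eta> within {0..\<eta>})"
      by (intro tendsto_within_subset[OF lim]) auto
    moreover have "at \<eta> within {0..\<eta>} \<noteq> bot"
      using at_within_Icc_at_left[OF \<open>\<eta> > 0\<close>] by simp
    ultimately have "\<epsilon> \<le> ?K \<eta>"
      by (intro tendsto_lowerbound[of ?K]) (auto intro!: always_eventually left simp: eventually_at_filter)
    with le show ?thesis by simp
  qed simp
qed

text \<open>Slackness turns \<open>D \<eta>\<close> into the objective at
  \<open>tilted \<eta>\<close>, and feasibility makes the penalty nonpositive, so weak duality gives
  optimality. Its equality case gives uniqueness.\<close>

lemma tilted_maximizer_optimal:
  assumes "\<eta> \<ge> 0" and max: "\<And>\<eta>'. \<eta>' \<ge> 0 \<Longrightarrow> D \<eta>' \<le> D \<eta>"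
  shows "is_arg_min (\<lambda>p. KL V p pi_tilde) (KL_feasible V pi_old \<epsilon>) p \<longleftrightarrow> p = tilted \<eta>"
proof -
  have feasible: "KL_feasible V pi_old \<epsilon> (tilted \<eta>)"
    using KL_tilted_maximizer_le[OF assms] tilted_on by (simp add: KL_feasible_def)
  have D: "D \<eta> = KL V (tilted \<eta>) pi_tilde"
    using D_eq_lagrangian_tilted[OF \<open>\<eta> \<ge> 0\<close>] complementary_slackness[OF assms] by simp
  have lagrangian_le: "KL V p pi_tilde + \<eta> * (KL V p pi_old - \<epsilon>) \<le> KL V p pi_tilde"
    if "KL_feasible V pi_old \<epsilon> p" for p
    using that \<open>\<eta> \<ge> 0\<close> by (simp add: KL_feasible_def mult_le_0_iff)
  have le: "KL V (tilted \<eta>) pi_tilde \<le> KL V p pi_tilde" if "KL_feasible V pi_old \<epsilon> p" for p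
    using D_le_lagrangian[of p, OF _ \<open>\<eta> \<ge> 0\<close>] lagrangian_le[OF that] that D
    by (simp add: KL_feasible_def)
  have unique: "p = tilted \<eta>"
    if "KL_feasible V pi_old \<epsilon> p" "KL V p pi_tilde \<le> KL V (tilted \<eta>) pi_tilde" for p
    using D_eq_lagrangian_imp_eq_tilted[of p, OF _ \<open>\<eta> \<ge> 0\<close>] lagrangian_le[OF that(1)] that D
    by (simp add: KL_feasible_def)
  show ?thesis
    using feasible le unique by (auto simp: is_arg_min_linorder)
qed

section \<open>Uniqueness of the dual maximiser\<close>

text \<open>Up to the normaliser, \<open>ln (pmf (tilted \<theta>) x)\<close> is affine in
  \<open>1 / (\<theta> + 1)\<close> with slope the log ratio of \<open>pi_tilde\<close> to
  \<open>pi_old\<close>. Agreement at two parameters makes that ratio independent of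
  \<open>x\<close>, and normalisation makes it 1.\<close>

lemma tilted_eq_imp_tilde_eq_old:
  assumes "\<eta> \<ge> 0" "\<eta>' \<ge> 0" "\<eta> \<noteq> \<eta>'" and eq: "tilted \<eta> = tilted \<eta>'"
  shows "pi_tilde = pi_old"
proof -
  define c where "c = 1 / (\<eta> + 1) - 1 / (\<eta>' + 1)"
  \<comment> \<open>The common log ratio, from subtracting the two affine formulas and dividing by
    \<open>c\<close>.\<close>
  define k where "k = (ln (partition_fun \<eta>) - ln (partition_fun \<eta>')) / c"
  have "c \<noteq> 0" using assms by (simp add: c_def divide_simps)
  have ln_tilted: "ln (pmf (tilted \<theta>) x) = ln (pmf pi_old x)
      + (ln (pmf pi_tilde x) - ln (pmf pi_old x)) * (1 / (\<theta> + 1)) - ln (partition_fun \<theta>)"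
    if "x \<in> V" "\<theta> \<ge> 0" for x \<theta>
  proof -
    have "(ln (pmf pi_tilde x) + \<theta> * ln (pmf pi_old x)) / (\<theta> + 1)
        = ln (pmf pi_old x) + (ln (pmf pi_tilde x) - ln (pmf pi_old x)) * (1 / (\<theta> + 1))"
      using \<open>\<theta> \<ge> 0\<close> by (simp add: field_simps)
    then show ?thesis
      using that partition_fun_pos[of \<theta>] by (simp add: pmf_tilted ln_div weight_def)
  qed
  have ratio: "pmf pi_tilde x = exp k * pmf pi_old x" if "x \<in> V" for x
  proof -
    have "(ln (pmf pi_tilde x) - ln (pmf pi_old x)) * c
        = ln (partition_fun \<eta>) - ln (partition_fun \<eta>')"
      using ln_tilted[OF that \<open>\<eta> \<ge> 0\<close>] ln_tilted[OF that \<open>\<eta>' \<ge> 0\<close>] eq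
      unfolding c_def by (simp add: right_diff_distrib)
    then have "ln (pmf pi_tilde x) = k + ln (pmf pi_old x)"
      using \<open>c \<noteq> 0\<close> by (simp add: k_def field_simps)
    then have "exp (ln (pmf pi_tilde x)) = exp k * exp (ln (pmf pi_old x))"
      by (simp add: exp_add)
    then show ?thesis using tilde_pos[OF that] old_pos[OF that] by simp
  qed
  have "(\<Sum>x\<in>V. pmf pi_tilde x) = exp k * (\<Sum>x\<in>V. pmf pi_old x)"
    by (simp add: ratio sum_distrib_left)
  then have "exp k = 1"
    using tilde_on old_on fin by (simp add: distributions_on_def sum_pmf_eq_1)
  show ?thesis
  proof (rule pmf_eqI)
    fix x
    show "pmf pi_tilde x = pmf pi_old x"
      using ratio[of x] \<open>exp k = 1\<close> pmf_outside[OF tilde_on] pmf_outside[OF old_on]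
      by (cases "x \<in> V") auto
  qed
qed

text \<open>The geometric mean of a distribution with itself is that distribution, so the partition
  function is 1.\<close>

lemma D_tilde_eq_old:
  assumes "pi_tilde = pi_old" "\<eta> \<ge> 0"
  shows "D \<eta> = - \<eta> * \<epsilon>"
proof -
  have "weight \<eta> x = pmf pi_old x" if "x \<in> V" for x
  proof -
    have "(ln (pmf pi_old x) + \<eta> * ln (pmf pi_old x)) / (\<eta> + 1) = ln (pmf pi_old x)"
      using \<open>\<eta> \<ge> 0\<close> by (simp add: field_simps)
    then show ?thesis unfolding weight_def unfolding assms(1) using old_pos[OF that] by simp
  qed
  then have "partition_fun \<eta> = 1"
    using old_on fin by (simp add: partition_fun_def distributions_on_def sum_pmf_eq_1)
  then show ?thesis by (simp add: D_eq)
qed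

text \<open>Both tilted distributions equal the unique primal solution. Distinct maximisers would
  then make \<open>D\<close> the strictly decreasing \<open>- \<eta> * \<epsilon>\<close>, which
  cannot take its maximum twice.\<close>

lemma maximizer_unique:
  assumes "\<eta> \<ge> 0" and max: "\<And>\<theta>. \<theta> \<ge> 0 \<Longrightarrow> D \<theta> \<le> D \<eta>"
    and "\<eta>' \<ge> 0" and max': "\<And>\<theta>. \<theta> \<ge> 0 \<Longrightarrow> D \<theta> \<le> D \<eta>'"
  shows "\<eta> = \<eta>'"
proof (rule ccontr)
  assume "\<eta> \<noteq> \<eta>'"
  have "tilted \<eta> = tilted \<eta>'"
    using tilted_maximizer_optimal[of \<eta>] tilted_maximizer_optimal[of \<eta>'] assms by blast
  then have "pi_tilde = pi_old"
    using tilted_eq_imp_tilde_eq_old \<open>\<eta> \<noteq> \<eta>'\<close> assms by blast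
  moreover have "D \<eta> = D \<eta>'" using assms by (simp add: antisym)
  ultimately show False using D_tilde_eq_old assms(1,3) eps_pos \<open>\<eta> \<noteq> \<eta>'\<close> by simp
qed

lemma is_arg_max_D_iff:
  "is_arg_max (dual_objective V pi_tilde pi_old \<epsilon>) (\<lambda>\<eta>. \<eta> \<ge> 0) \<eta> \<longleftrightarrow>
    \<eta> \<ge> 0 \<and> (\<forall>\<eta>'\<ge>0. D \<eta>' \<le> D \<eta>)"
  unfolding D_def by (auto simp: is_arg_max_linorder)

end

theorem mainTheorem1:
  fixes V :: "'a set" and pi_tilde pi_old :: "'a pmf" and \<epsilon> :: real
  assumes "finite V" and "V \<noteq> {}"
    and "pi_tilde \<in> distributions_on V" and "pi_old \<in> distributions_on V"
    and "\<forall>x\<in>V. pmf pi_tilde x > 0" and "\<forall>x\<in>V. pmf pi_old x > 0"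
    and "\<epsilon> > 0"
  shows "(\<exists>!\<eta>. is_arg_max (dual_objective V pi_tilde pi_old \<epsilon>) (\<lambda>\<eta>. \<eta> \<ge> 0) \<eta>) \<and>
    (\<exists>!\<pi>. is_arg_min (\<lambda>p. KL V p pi_tilde) (KL_feasible V pi_old \<epsilon>) \<pi>) \<and>
    (\<forall>\<eta> \<pi>.
      is_arg_max (dual_objective V pi_tilde pi_old \<epsilon>) (\<lambda>\<eta>. \<eta> \<ge> 0) \<eta> \<longrightarrow>
      is_arg_min (\<lambda>p. KL V p pi_tilde) (KL_feasible V pi_old \<epsilon>) \<pi> \<longrightarrow>
      (\<forall>x\<in>V. pmf \<pi> x =
        exp ((\<eta> * ln (pmf pi_old x) + ln (pmf pi_tilde x)) / (\<eta> + 1)) /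
        (\<Sum>y\<in>V. exp ((\<eta> * ln (pmf pi_old y) + ln (pmf pi_tilde y)) / (\<eta> + 1)))))"
proof -
  interpret KL_projection V pi_tilde pi_old \<epsilon>
    using assms by unfold_locales auto
  obtain \<eta>\<^sub>0 where \<eta>\<^sub>0: "\<eta>\<^sub>0 \<ge> 0" "\<forall>\<eta>'\<ge>0. D \<eta>' \<le> D \<eta>\<^sub>0"
    using maximizer_exists by blast
  have "\<exists>!\<eta>. is_arg_max (dual_objective V pi_tilde pi_old \<epsilon>) (\<lambda>\<eta>. \<eta> \<ge> 0) \<eta>"
    unfolding is_arg_max_D_iff using \<eta>\<^sub>0 maximizer_unique by blast
  moreover have "\<exists>!\<pi>. is_arg_min (\<lambda>p. KL V p pi_tilde) (KL_feasible V pi_old \<epsilon>) \<pi>"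
    using tilted_maximizer_optimal[of \<eta>\<^sub>0] \<eta>\<^sub>0 by simp
  moreover have "pmf \<pi> x =
        exp ((\<eta> * ln (pmf pi_old x) + ln (pmf pi_tilde x)) / (\<eta> + 1)) /
        (\<Sum>y\<in>V. exp ((\<eta> * ln (pmf pi_old y) + ln (pmf pi_tilde y)) / (\<eta> + 1)))"
    if "is_arg_max (dual_objective V pi_tilde pi_old \<epsilon>) (\<lambda>\<eta>. \<eta> \<ge> 0) \<eta>"
      and "is_arg_min (\<lambda>p. KL V p pi_tilde) (KL_feasible V pi_old \<epsilon>) \<pi>" and "x \<in> V"
    for \<eta> \<pi> x
  proof -
    have "\<pi> = tilted \<eta>"
      using that(1,2) tilted_maximizer_optimal[of \<eta>] unfolding is_arg_max_D_iff by blast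
    \<comment> \<open>Commutativity reconciles the order of summands in the exponent with that in
      \<open>weight\<close>.\<close>
    with \<open>x \<in> V\<close> show ?thesis
      by (simp add: pmf_tilted partition_fun_def weight_def add.commute)
  qed
  ultimately show ?thesis by blast
qed

end
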